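(* Let $X$ be a set, $R\subseteq X\times X$ and $u,v\in\beta X$. Then $R^*(u,v)$ holds if and only if there exists an ultrafilter $w\in\beta(X\times X)$ such that $R\in w$ and $$\{\mathrm{pr}_1(S):S\in w\}=u\quad\text{and}\quad\{\mathrm{pr}_2(S):S\in w\}=v.$$
   Context: For a set $Z$, $\beta Z$ denotes the set of ultrafilters over $Z$. For $R\subseteq X\times X$ and $u,v\in\beta X$, $$R^*(u,v)\iff(\forall S\in v)\ \{x:(\exists y\in S)\,R(x,y)\}\in u.$$ For $S\subseteq X\times X$, $\mathrm{pr}_1(S)=\{x:(\exists y)\,(x,y)\in S\}$ and $\mathrm{pr}_2(S)=\{y:(\exists x)\,(x,y)\in S\}$. *)

theory Defs
  imports Main
begin

definition filter_over :: "'a set \<Rightarrow> 'a set set \<Rightarrow> bool" where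
  "filter_over Z F \<longleftrightarrow>
     F \<subseteq> Pow Z \<and> Z \<in> F \<and> {} \<notin> F \<and>
     (\<forall>A\<in>F. \<forall>B\<in>F. A \<inter> B \<in> F) \<and>
     (\<forall>A\<in>F. \<forall>B. A \<subseteq> B \<and> B \<subseteq> Z \<longrightarrow> B \<in> F)"

text \<open>The set of all ultrafilters over \<open>Z\<close>, principal ones included; it is empty if \<open>Z\<close> is.\<close>

definition beta :: "'a set \<Rightarrow> 'a set set set" where
  "beta Z = {u. filter_over Z u \<and> (\<forall>A\<subseteq>Z. A \<in> u \<or> Z - A \<in> u)}"

text \<open>
  The carrier \<open>X\<close> is not an argument: for \<open>R \<subseteq> X \<times> X\<close> the set below is automatically a
  subset of \<open>X\<close>.
\<close>

definition star_ext :: "('a \<times> 'a) set \<Rightarrow> 'a set set \<Rightarrow> 'a set set \<Rightarrow> bool" where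
  "star_ext R u v \<longleftrightarrow> (\<forall>S\<in>v. {x. \<exists>y\<in>S. (x, y) \<in> R} \<in> u)"

end

theory Submission
  imports Defs
begin

text \<open>
  If \<open>w\<close> projects to \<open>u\<close> and \<open>v\<close> and contains \<open>R\<close>, then each \<open>S \<in> v\<close> is the second
  projection of some \<open>T \<in> w\<close>, and the first projection of \<open>R \<inter> T \<in> w\<close> is a member of \<open>u\<close>
  all of whose elements are \<open>R\<close>-related to an element of \<open>S\<close>.

  Conversely, \<open>star_ext R u v\<close> says exactly that \<open>R\<close> meets every rectangle \<open>A \<times> B\<close> with
  \<open>A \<in> u\<close> and \<open>B \<in> v\<close>. So the sets \<open>R \<inter> (A \<times> B)\<close> form a base of a proper filter, which
  extends to an ultrafilter \<open>w\<close> by Zorn's lemma (\<open>ultrafilter_extends_base\<close>). It contains all cylinders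
  \<open>A \<times> X\<close> and \<open>X \<times> B\<close> over members of \<open>u\<close> and \<open>v\<close>, and this already forces its
  projections to be \<open>u\<close> and \<open>v\<close> (\<open>Domain_members_eq\<close>, \<open>Range_members_eq\<close>).
\<close>

lemma beta_subset: "w \<in> beta Z \<Longrightarrow> A \<in> w \<Longrightarrow> A \<subseteq> Z"
  by (auto simp: beta_def filter_over_def)

lemma beta_carrier: "w \<in> beta Z \<Longrightarrow> Z \<in> w"
  by (simp add: beta_def filter_over_def)

lemma beta_nonempty: "w \<in> beta Z \<Longrightarrow> A \<in> w \<Longrightarrow> A \<noteq> {}"
  by (auto simp: beta_def filter_over_def)

lemma beta_Int: "w \<in> beta Z \<Longrightarrow> A \<in> w \<Longrightarrow> B \<in> w \<Longrightarrow> A \<inter> B \<in> w"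
  by (simp add: beta_def filter_over_def)

lemma beta_upward: "w \<in> beta Z \<Longrightarrow> A \<in> w \<Longrightarrow> A \<subseteq> B \<Longrightarrow> B \<subseteq> Z \<Longrightarrow> B \<in> w"
  unfolding beta_def filter_over_def by blast

lemma beta_compl: "w \<in> beta Z \<Longrightarrow> A \<subseteq> Z \<Longrightarrow> A \<notin> w \<Longrightarrow> Z - A \<in> w"
  by (auto simp: beta_def)

lemma filter_over_upward_closure:
  assumes "\<B> \<noteq> {}" and "\<B> \<subseteq> Pow Z" and "{} \<notin> \<B>"
    and "\<And>A B. A \<in> \<B> \<Longrightarrow> B \<in> \<B> \<Longrightarrow> \<exists>C\<in>\<B>. C \<subseteq> A \<inter> B"
  shows "filter_over Z {C. C \<subseteq> Z \<and> (\<exists>B\<in>\<B>. B \<subseteq> C)}"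
  unfolding filter_over_def
proof (intro conjI ballI allI impI)
  fix C D
  assume "C \<in> {C. C \<subseteq> Z \<and> (\<exists>B\<in>\<B>. B \<subseteq> C)}" and "D \<in> {C. C \<subseteq> Z \<and> (\<exists>B\<in>\<B>. B \<subseteq> C)}"
  then obtain A B where "A \<in> \<B>" "A \<subseteq> C" "B \<in> \<B>" "B \<subseteq> D" "C \<subseteq> Z" by blast
  moreover obtain E where "E \<in> \<B>" "E \<subseteq> A \<inter> B"
    using assms(4)[OF \<open>A \<in> \<B>\<close> \<open>B \<in> \<B>\<close>] by blast
  ultimately have "E \<subseteq> C \<inter> D" "C \<inter> D \<subseteq> Z" by auto
  with \<open>E \<in> \<B>\<close> show "C \<inter> D \<in> {C. C \<subseteq> Z \<and> (\<exists>B\<in>\<B>. B \<subseteq> C)}" by blast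
next
  fix A B assume "A \<in> {C. C \<subseteq> Z \<and> (\<exists>B\<in>\<B>. B \<subseteq> C)}" and "A \<subseteq> B \<and> B \<subseteq> Z"
  then show "B \<in> {C. C \<subseteq> Z \<and> (\<exists>B\<in>\<B>. B \<subseteq> C)}" by (auto intro: order_trans)
qed (use assms(1-3) in auto)

lemma filter_over_Union_chain:
  assumes "\<C> \<noteq> {}" and "subset.chain {F. filter_over Z F} \<C>"
  shows "filter_over Z (\<Union>\<C>)"
proof -
  have filt: "filter_over Z F" if "F \<in> \<C>" for F
    using assms(2) that by (auto simp: subset_chain_def)
  show ?thesis
    unfolding filter_over_def
  proof (intro conjI ballI allI impI)
    fix A B assume "A \<in> \<Union>\<C>" "B \<in> \<Union>\<C>"
    then obtain F G where FG: "F \<in> \<C>" "A \<in> F" "G \<in> \<C>" "B \<in> G" by blast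
    then have "F \<subseteq> G \<or> G \<subseteq> F" using assms(2) by (auto simp: subset_chain_def)
    then obtain H where "H \<in> \<C>" "A \<in> H" "B \<in> H" using FG by blast
    then show "A \<inter> B \<in> \<Union>\<C>" using filt[of H] unfolding filter_over_def by blast
  next
    fix A B assume "A \<in> \<Union>\<C>" "A \<subseteq> B \<and> B \<subseteq> Z"
    then show "B \<in> \<Union>\<C>" using filt unfolding filter_over_def by blast
  qed (use filt assms(1) in \<open>unfold filter_over_def, blast\<close>)+
qed

lemma maximal_filter_in_beta:
  assumes M: "filter_over Z M"
    and maximal: "\<And>F. filter_over Z F \<Longrightarrow> M \<subseteq> F \<Longrightarrow> F = M"
  shows "M \<in> beta Z"
proof -
  have "A \<in> M \<or> Z - A \<in> M" if "A \<subseteq> Z" for A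
  proof (rule ccontr)
    assume contra: "\<not> (A \<in> M \<or> Z - A \<in> M)"
    \<comment> \<open>\<open>M\<close> and \<open>A\<close> together generate a filter, proper because \<open>Z - A \<notin> M\<close>.\<close>
    let ?F = "{C. C \<subseteq> Z \<and> (\<exists>B\<in>(\<lambda>B. B \<inter> A) ` M. B \<subseteq> C)}"
    have "B \<inter> A \<noteq> {}" if "B \<in> M" for B
    proof
      assume "B \<inter> A = {}"
      moreover have "B \<subseteq> Z" using M that by (auto simp: filter_over_def)
      ultimately have "B \<subseteq> Z - A" by blast
      then show False using M that contra unfolding filter_over_def by blast
    qed
    then have "{} \<notin> (\<lambda>B. B \<inter> A) ` M" by blast
    moreover have "\<exists>E\<in>(\<lambda>B. B \<inter> A) ` M. E \<subseteq> C \<inter> D"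
      if "C \<in> (\<lambda>B. B \<inter> A) ` M" "D \<in> (\<lambda>B. B \<inter> A) ` M" for C D
    proof -
      from that obtain B B' where B: "B \<in> M" "B' \<in> M" "C = B \<inter> A" "D = B' \<inter> A" by blast
      then have "B \<inter> B' \<in> M" using M by (simp add: filter_over_def)
      then have "B \<inter> B' \<inter> A \<in> (\<lambda>B. B \<inter> A) ` M" by (rule imageI)
      moreover have "B \<inter> B' \<inter> A \<subseteq> C \<inter> D" using B by auto
      ultimately show ?thesis by (rule rev_bexI)
    qed
    ultimately have "filter_over Z ?F"
      using M \<open>A \<subseteq> Z\<close> by (intro filter_over_upward_closure) (auto simp: filter_over_def)
    moreover have "M \<subseteq> ?F" using M by (auto simp: filter_over_def)
    ultimately have "?F = M" by (rule maximal)
    moreover have "A \<in> ?F" using M \<open>A \<subseteq> Z\<close> by (auto simp: filter_over_def)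
    ultimately show False using contra by simp
  qed
  then show ?thesis using M by (simp add: beta_def)
qed

lemma ultrafilter_extends_filter:
  assumes "filter_over Z F"
  shows "\<exists>w\<in>beta Z. F \<subseteq> w"
proof -
  have "\<exists>M\<in>{G. filter_over Z G \<and> F \<subseteq> G}.
      \<forall>G\<in>{G. filter_over Z G \<and> F \<subseteq> G}. M \<subseteq> G \<longrightarrow> G = M"
  proof (rule subset_Zorn_nonempty)
    show "{G. filter_over Z G \<and> F \<subseteq> G} \<noteq> {}" using assms by blast
  next
    fix \<C> assume ne: "\<C> \<noteq> {}" and ch: "subset.chain {G. filter_over Z G \<and> F \<subseteq> G} \<C>"
    then have "subset.chain {G. filter_over Z G} \<C>" by (auto simp: subset_chain_def)
    with ne have "filter_over Z (\<Union>\<C>)" by (rule filter_over_Union_chain)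
    moreover have "F \<subseteq> \<Union>\<C>" using ne ch by (force simp: subset_chain_def)
    ultimately show "\<Union>\<C> \<in> {G. filter_over Z G \<and> F \<subseteq> G}" by blast
  qed
  then obtain M where "M \<in> {G. filter_over Z G \<and> F \<subseteq> G}"
    and maximal: "\<forall>G\<in>{G. filter_over Z G \<and> F \<subseteq> G}. M \<subseteq> G \<longrightarrow> G = M" ..
  then have M: "filter_over Z M" "F \<subseteq> M" by simp_all
  have "M \<in> beta Z"
  proof (rule maximal_filter_in_beta[OF M(1)])
    fix G assume "filter_over Z G" and "M \<subseteq> G"
    moreover from this have "F \<subseteq> G" using M(2) by simp
    ultimately show "G = M" using maximal by simp
  qed
  with M(2) show ?thesis by blast
qed

text \<open>The ultrafilter theorem, stated for a filter base.\<close>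

lemma ultrafilter_extends_base:
  assumes "\<B> \<noteq> {}" and "\<B> \<subseteq> Pow Z" and "{} \<notin> \<B>"
    and "\<And>A B. A \<in> \<B> \<Longrightarrow> B \<in> \<B> \<Longrightarrow> \<exists>C\<in>\<B>. C \<subseteq> A \<inter> B"
  shows "\<exists>w\<in>beta Z. \<B> \<subseteq> w"
proof -
  obtain w where "w \<in> beta Z" "{C. C \<subseteq> Z \<and> (\<exists>B\<in>\<B>. B \<subseteq> C)} \<subseteq> w"
    using ultrafilter_extends_filter[OF filter_over_upward_closure[OF assms]] by blast
  then show ?thesis using assms(2) by blast
qed

text \<open>
  Projecting the cylinders gives every member of \<open>u\<close>. Nothing else arises, since the
  cylinder over \<open>X - Domain S\<close> is disjoint from \<open>S\<close>.
\<close>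

lemma Domain_members_eq:
  assumes w: "w \<in> beta (X \<times> Y)" and u: "u \<in> beta X"
    and cyl: "\<And>A. A \<in> u \<Longrightarrow> A \<times> Y \<in> w"
  shows "{Domain S | S. S \<in> w} = u"
proof (intro equalityI subsetI)
  fix A assume "A \<in> u"
  have "Y \<noteq> {}" using beta_nonempty[OF w beta_carrier[OF w]] by blast
  then have "A = Domain (A \<times> Y)" by auto
  then show "A \<in> {Domain S | S. S \<in> w}" using cyl[OF \<open>A \<in> u\<close>] by blast
next
  fix A assume "A \<in> {Domain S | S. S \<in> w}"
  then obtain S where S: "S \<in> w" "A = Domain S" by blast
  show "A \<in> u"
  proof (rule ccontr)
    assume "A \<notin> u"
    moreover have "A \<subseteq> X" using beta_subset[OF w S(1)] S(2) by blast
    ultimately have "(X - A) \<times> Y \<in> w" using beta_compl[OF u] cyl by blast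
    then have "S \<inter> ((X - A) \<times> Y) \<in> w" using beta_Int[OF w S(1)] by blast
    then show False using beta_nonempty[OF w] S(2) by blast
  qed
qed

lemma Range_members_eq:
  assumes w: "w \<in> beta (X \<times> Y)" and v: "v \<in> beta Y"
    and cyl: "\<And>B. B \<in> v \<Longrightarrow> X \<times> B \<in> w"
  shows "{Range S | S. S \<in> w} = v"
proof (intro equalityI subsetI)
  fix B assume "B \<in> v"
  have "X \<noteq> {}" using beta_nonempty[OF w beta_carrier[OF w]] by blast
  then have "B = Range (X \<times> B)" by auto
  then show "B \<in> {Range S | S. S \<in> w}" using cyl[OF \<open>B \<in> v\<close>] by blast
next
  fix B assume "B \<in> {Range S | S. S \<in> w}"
  then obtain S where S: "S \<in> w" "B = Range S" by blast
  show "B \<in> v"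
  proof (rule ccontr)
    assume "B \<notin> v"
    moreover have "B \<subseteq> Y" using beta_subset[OF w S(1)] S(2) by blast
    ultimately have "X \<times> (Y - B) \<in> w" using beta_compl[OF v] cyl by blast
    then have "S \<inter> (X \<times> (Y - B)) \<in> w" using beta_Int[OF w S(1)] by blast
    then show False using beta_nonempty[OF w] S(2) by blast
  qed
qed

lemma star_ext_meets_rectangle:
  assumes "u \<in> beta X" and "star_ext R u v" and "A \<in> u" and "B \<in> v"
  shows "R \<inter> (A \<times> B) \<noteq> {}"
proof -
  have "{x. \<exists>y\<in>B. (x, y) \<in> R} \<in> u" using assms(2,4) by (simp add: star_ext_def)
  with assms(1,3) have "A \<inter> {x. \<exists>y\<in>B. (x, y) \<in> R} \<noteq> {}"
    by (intro beta_nonempty[OF assms(1)] beta_Int[OF assms(1)])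
  then show ?thesis by blast
qed

theorem theorem3:
  fixes X :: "'a set" and R :: "('a \<times> 'a) set" and u v :: "'a set set"
  assumes "R \<subseteq> X \<times> X" and "u \<in> beta X" and "v \<in> beta X"
  shows "star_ext R u v \<longleftrightarrow>
    (\<exists>w \<in> beta (X \<times> X). R \<in> w \<and> {Domain S | S. S \<in> w} = u \<and> {Range S | S. S \<in> w} = v)"
proof
  assume star: "star_ext R u v"
  let ?\<B> = "{R \<inter> (A \<times> B) | A B. A \<in> u \<and> B \<in> v}"
  have X: "X \<in> u" "X \<in> v" using assms(2,3) by (simp_all add: beta_carrier)
  have "\<exists>w\<in>beta (X \<times> X). ?\<B> \<subseteq> w"
  proof (rule ultrafilter_extends_base)
    show "?\<B> \<noteq> {}" using X by blast
    show "?\<B> \<subseteq> Pow (X \<times> X)" using assms(1) by blast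
    show "{} \<notin> ?\<B>" using star_ext_meets_rectangle[OF assms(2) star] by fastforce
  next
    fix C D assume "C \<in> ?\<B>" "D \<in> ?\<B>"
    then obtain A B A' B' where
      AB: "A \<in> u" "B \<in> v" "A' \<in> u" "B' \<in> v" "C = R \<inter> (A \<times> B)" "D = R \<inter> (A' \<times> B')"
      by blast
    then have "A \<inter> A' \<in> u" "B \<inter> B' \<in> v" using beta_Int assms(2,3) by blast+
    then have "R \<inter> ((A \<inter> A') \<times> (B \<inter> B')) \<in> ?\<B>" by blast
    moreover have "R \<inter> ((A \<inter> A') \<times> (B \<inter> B')) \<subseteq> C \<inter> D" using AB by blast
    ultimately show "\<exists>E\<in>?\<B>. E \<subseteq> C \<inter> D" by (rule rev_bexI)
  qed
  then obtain w where w: "w \<in> beta (X \<times> X)" and sub: "?\<B> \<subseteq> w" ..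
  have base: "R \<inter> (A \<times> B) \<in> w" if "A \<in> u" "B \<in> v" for A B
    by (rule subsetD[OF sub]) (use that in blast)
  have rect: "A \<times> B \<in> w" if "A \<in> u" "B \<in> v" for A B
  proof (rule beta_upward[OF w base[OF that]])
    show "A \<times> B \<subseteq> X \<times> X"
      using beta_subset[OF assms(2) that(1)] beta_subset[OF assms(3) that(2)] by blast
  qed blast
  have "R \<in> w" using beta_upward[OF w base[OF X]] assms(1) by blast
  moreover have "{Domain S | S. S \<in> w} = u"
    using w assms(2) by (rule Domain_members_eq) (simp add: rect X)
  moreover have "{Range S | S. S \<in> w} = v"
    using w assms(3) by (rule Range_members_eq) (simp add: rect X)
  ultimately show "\<exists>w \<in> beta (X \<times> X).
      R \<in> w \<and> {Domain S | S. S \<in> w} = u \<and> {Range S | S. S \<in> w} = v"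
    using w by blast
next
  assume "\<exists>w \<in> beta (X \<times> X).
      R \<in> w \<and> {Domain S | S. S \<in> w} = u \<and> {Range S | S. S \<in> w} = v"
  then obtain w where w: "w \<in> beta (X \<times> X)" "R \<in> w"
    and dom: "{Domain S | S. S \<in> w} = u" and ran: "{Range S | S. S \<in> w} = v" by blast
  show "star_ext R u v"
    unfolding star_ext_def
  proof
    fix S assume "S \<in> v"
    then obtain T where T: "T \<in> w" "S = Range T" using ran by blast
    have "R \<inter> T \<in> w" using beta_Int[OF w T(1)] .
    then have "Domain (R \<inter> T) \<in> u" using dom by blast
    then show "{x. \<exists>y\<in>S. (x, y) \<in> R} \<in> u"
      by (rule beta_upward[OF assms(2)]) (use T(2) assms(1) in blast)+
  qed
qed

end
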